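(* Let $d\ge 6$ be an integer and let $R=\mathbb{C}[M_1,\dots,M_d]$. Let $\tilde I_d^{\mathrm{inv}}\subseteq R$ be the ideal generated by the $\binom{d-2}{2}$ polynomials $$(j-i+3)\,M_{i-2}M_{i-1}M_{j+1}M_{j+2}-2(j-i+2)\,M_{i-2}M_{i}M_{j}M_{j+2}+(j-i+1)\,M_{i-1}M_{i}M_{j}M_{j+1}$$ for $2\le i\le j\le d-2$, where $M_0=1$. Then the affine Pareto moment ideal (in $R$) is equal to the saturation $$\tilde I_d^{\mathrm{inv}} : (M_1\cdots M_d)^{\infty}.$$
   Context: For $i<\alpha$, the $i$-th moment of the Pareto distribution with parameters $\alpha,\xi\in\mathbb{R}_{>0}$ is $m_i=\frac{\alpha}{\alpha-i}\xi^i$. The Pareto moment variety $\mathcal{Y}\subseteq\mathbb{P}^d$ (projective space over $\mathbb{C}$) is the Zariski closure over $\mathbb{C}$ of the image of the map $\mathbb{R}_{>d}\times\mathbb{R}_{>0}\to\mathbb{P}^d$, $(\alpha,\xi)\mapsto\left[\frac{\alpha}{\alpha-i}\xi^i\right]_{0\le i\le d}$. The affine Pareto moment ideal is the dehomogenization (setting $M_0=1$) in $\mathbb{C}[M_1,\dots,M_d]$ of the homogeneous vanishing ideal of $\mathcal{Y}$ in $\mathbb{C}[M_0,\dots,M_d]$. For an ideal $I\subseteq R$ and $g\in R$, the saturation is $I:g^\infty=\{f\in R\mid g^k f\in I\text{ for some }k\in\mathbb{N}\}$. *)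

theory Defs
  imports Complex_Main "HOL-Library.Poly_Mapping" "HOL-Algebra.Ideal"
begin

text \<open>Polynomials over \<open>\<complex>\<close> in variables indexed by \<open>nat\<close>: a monomial maps variable indices to
  exponents, a polynomial maps monomials to coefficients.\<close>

type_synonym cmpoly = "(nat \<Rightarrow>\<^sub>0 nat) \<Rightarrow>\<^sub>0 complex"

definition Var :: "nat \<Rightarrow> cmpoly"
  where "Var i = Poly_Mapping.single (Poly_Mapping.single i 1) 1"

definition Const :: "complex \<Rightarrow> cmpoly"
  where "Const c = Poly_Mapping.single 0 c"

definition mpoly_ring :: "nat set \<Rightarrow> cmpoly ring"
  where "mpoly_ring V =
    \<lparr>carrier = {p. \<forall>m\<in>Poly_Mapping.keys p. Poly_Mapping.keys m \<subseteq> V},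
     mult = (*), one = 1, zero = 0, add = (+)\<rparr>"

lemma mpoly_ring_cring: "cring (mpoly_ring V)"
proof (rule cringI)
  let ?C = "carrier (mpoly_ring V)"
  have add: "p + q \<in> ?C" if "p \<in> ?C" "q \<in> ?C" for p q
    using that Poly_Mapping.keys_add[of p q] by (auto simp: mpoly_ring_def)
  have mult: "p * q \<in> ?C" if "p \<in> ?C" "q \<in> ?C" for p q
  proof -
    have "Poly_Mapping.keys m \<subseteq> V" if m: "m \<in> Poly_Mapping.keys (p * q)" for m
    proof -
      from m keys_mult[of p q] obtain a b where ab: "a \<in> Poly_Mapping.keys p"
        "b \<in> Poly_Mapping.keys q" "m = a + b" by blast
      have "Poly_Mapping.keys a \<subseteq> V" "Poly_Mapping.keys b \<subseteq> V"
        using ab \<open>p \<in> ?C\<close> \<open>q \<in> ?C\<close> by (simp_all add: mpoly_ring_def)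
      then show ?thesis
        unfolding ab(3) using Poly_Mapping.keys_add[of a b] by (meson Un_least subset_trans)
    qed
    then show ?thesis by (simp add: mpoly_ring_def)
  qed
  have ops [simp]: "mult (mpoly_ring V) = (*)" "one (mpoly_ring V) = 1"
    "zero (mpoly_ring V) = 0" "add (mpoly_ring V) = (+)"
    by (simp_all add: mpoly_ring_def)
  have uminus: "- p \<in> ?C" if "p \<in> ?C" for p
    using that by (simp add: mpoly_ring_def)
  have zero_one: "0 \<in> ?C" "1 \<in> ?C"
    by (simp_all add: mpoly_ring_def)
  show "abelian_group (mpoly_ring V)"
  proof (rule abelian_groupI)
    show "\<exists>y\<in>?C. y \<oplus>\<^bsub>mpoly_ring V\<^esub> x = \<zero>\<^bsub>mpoly_ring V\<^esub>" if "x \<in> ?C" for x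
      using uminus[OF that] by (intro bexI[of _ "- x"]) simp_all
  qed (simp_all add: add zero_one ac_simps)
  show "Group.comm_monoid (mpoly_ring V)"
    by (rule comm_monoidI) (simp_all add: mult zero_one ac_simps)
  show "(x \<oplus>\<^bsub>mpoly_ring V\<^esub> y) \<otimes>\<^bsub>mpoly_ring V\<^esub> z =
      x \<otimes>\<^bsub>mpoly_ring V\<^esub> z \<oplus>\<^bsub>mpoly_ring V\<^esub> y \<otimes>\<^bsub>mpoly_ring V\<^esub> z" for x y z
    by (simp add: distrib_right)
qed

text \<open>Substitution of \<open>x i\<close> for the \<open>i\<close>-th variable, with \<open>h\<close> embedding the coefficients.\<close>

definition subst_eval :: "(complex \<Rightarrow> 'b) \<Rightarrow> (nat \<Rightarrow> 'b) \<Rightarrow> cmpoly \<Rightarrow> 'b::comm_ring_1"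
  where "subst_eval h x p =
    (\<Sum>m\<in>Poly_Mapping.keys p. h (Poly_Mapping.lookup p m) *
      (\<Prod>i\<in>Poly_Mapping.keys m. x i ^ Poly_Mapping.lookup m i))"

abbreviation peval :: "cmpoly \<Rightarrow> (nat \<Rightarrow> complex) \<Rightarrow> complex"
  where "peval p x \<equiv> subst_eval (\<lambda>c. c) x p"

definition homogeneous :: "cmpoly \<Rightarrow> bool"
  where "homogeneous p \<longleftrightarrow>
    (\<exists>n. \<forall>m\<in>Poly_Mapping.keys p. (\<Sum>i\<in>Poly_Mapping.keys m. Poly_Mapping.lookup m i) = n)"

text \<open>A vector of \<open>\<complex>\<^sup>d\<^sup>+\<^sup>1\<close> is a function \<open>nat \<Rightarrow> complex\<close> vanishing beyond index \<open>d\<close>; a point of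
  \<open>\<P>\<^sup>d\<close> is the set of all its homogeneous coordinate vectors.\<close>

definition nonzero_vecs :: "nat \<Rightarrow> (nat \<Rightarrow> complex) set"
  where "nonzero_vecs d = {x. (\<forall>i>d. x i = 0) \<and> (\<exists>i\<le>d. x i \<noteq> 0)}"

definition proportional :: "nat \<Rightarrow> ((nat \<Rightarrow> complex) \<times> (nat \<Rightarrow> complex)) set"
  where "proportional d =
    {(x, y). x \<in> nonzero_vecs d \<and> y \<in> nonzero_vecs d \<and> (\<exists>c. c \<noteq> 0 \<and> y = (\<lambda>i. c * x i))}"

definition proj_space :: "nat \<Rightarrow> (nat \<Rightarrow> complex) set set"
  where "proj_space d = nonzero_vecs d // proportional d"

definition proj_point :: "nat \<Rightarrow> (nat \<Rightarrow> complex) \<Rightarrow> (nat \<Rightarrow> complex) set"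
  where "proj_point d x = proportional d `` {\<lambda>i. if i \<le> d then x i else 0}"

definition vanishes_at :: "cmpoly \<Rightarrow> (nat \<Rightarrow> complex) set \<Rightarrow> bool"
  where "vanishes_at f P \<longleftrightarrow> (\<forall>x\<in>P. peval f x = 0)"

definition zariski_closed :: "nat \<Rightarrow> (nat \<Rightarrow> complex) set set \<Rightarrow> bool"
  where "zariski_closed d Z \<longleftrightarrow>
    (\<exists>S \<subseteq> {f \<in> carrier (mpoly_ring {0..d}). homogeneous f}.
       Z = {P \<in> proj_space d. \<forall>f\<in>S. vanishes_at f P})"

definition vanishing_ideal :: "nat \<Rightarrow> (nat \<Rightarrow> complex) set set \<Rightarrow> cmpoly set"
  where "vanishing_ideal d Y = Idl\<^bsub>mpoly_ring {0..d}\<^esub>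
    {f \<in> carrier (mpoly_ring {0..d}). homogeneous f \<and> (\<forall>P\<in>Y. vanishes_at f P)}"

text \<open>The variable \<open>M\<^sub>i\<close> with the convention \<open>M\<^sub>0 = 1\<close>.\<close>

definition M :: "nat \<Rightarrow> cmpoly"
  where "M i = (if i = 0 then 1 else Var i)"

definition dehomogenize :: "cmpoly \<Rightarrow> cmpoly"
  where "dehomogenize = subst_eval Const M"

definition saturation :: "('a, 'b) ring_scheme \<Rightarrow> 'a set \<Rightarrow> 'a \<Rightarrow> 'a set"
  where "saturation R I g = {f \<in> carrier R. \<exists>k::nat. (g [^]\<^bsub>R\<^esub> k) \<otimes>\<^bsub>R\<^esub> f \<in> I}"

definition pareto_moment :: "real \<Rightarrow> real \<Rightarrow> nat \<Rightarrow> real"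
  where "pareto_moment \<alpha> \<xi> i = \<alpha> / (\<alpha> - real i) * \<xi> ^ i"

definition pareto_variety :: "nat \<Rightarrow> (nat \<Rightarrow> complex) set set"
  where "pareto_variety d = zariski_closed d hull
    {proj_point d (\<lambda>i. of_real (pareto_moment \<alpha> \<xi> i)) | \<alpha> \<xi>. \<alpha> > real d \<and> \<xi> > 0}"

definition affine_pareto_moment_ideal :: "nat \<Rightarrow> cmpoly set"
  where "affine_pareto_moment_ideal d = dehomogenize ` vanishing_ideal d (pareto_variety d)"

definition inv_generator :: "nat \<Rightarrow> nat \<Rightarrow> cmpoly"
  where "inv_generator i j =
      (of_nat j - of_nat i + 3) * M (i - 2) * M (i - 1) * M (j + 1) * M (j + 2)
    - 2 * (of_nat j - of_nat i + 2) * M (i - 2) * M i * M j * M (j + 2)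
    + (of_nat j - of_nat i + 1) * M (i - 1) * M i * M j * M (j + 1)"

definition inv_ideal :: "nat \<Rightarrow> cmpoly set"
  where "inv_ideal d = Idl\<^bsub>mpoly_ring {1..d}\<^esub> {inv_generator i j | i j. 2 \<le> i \<and> i \<le> j \<and> j \<le> d - 2}"

end

theory Submission
  imports Defs "HOL-Computational_Algebra.Polynomial"
begin

text \<open>
  Work with the inverse moments \<open>N\<^sub>i = 1 / M\<^sub>i\<close>. At a Pareto point they are
  \<open>N\<^sub>i = (1 - i \<beta>) \<zeta>\<^sup>i\<close> with \<open>\<beta> = 1 / \<alpha>\<close> and \<open>\<zeta> = 1 / \<xi>\<close>, so they trace out the tangent
  developable of a rational normal curve, and each generator of the ideal is, up to a monomial
  factor, a quadric in the \<open>N\<^sub>i\<close> that vanishes on this surface. Hence everything in the saturation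
  vanishes at the Pareto points, and the affine Pareto moment ideal consists of all polynomials
  vanishing there (\<open>affine_pareto_moment_ideal_eq\<close>).

  For the other inclusion put \<open>u = N\<^sub>1\<close> and \<open>t = \<beta> \<zeta>\<close>. On the surface \<open>N\<^sub>2 = u\<^sup>2 - t\<^sup>2\<close> and
  \<open>N\<^sub>3 = u\<^sup>3 - 3 u t\<^sup>2 - 2 t\<^sup>3\<close>, so \<open>t\<^sup>2\<close> and \<open>t\<^sup>3\<close> are polynomials in \<open>N\<^sub>1, N\<^sub>2, N\<^sub>3\<close>; these
  polynomials make sense off the surface and are called \<open>t_squared\<close> and \<open>t_cubed\<close>. Two facts hold
  modulo the quadrics:

  \<^item> the quadrics with \<open>i = 2\<close> express each \<open>N\<^bsub>j+2\<^esub>\<close> through earlier ones, so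
    \<open>N\<^sub>1, N\<^sub>2, N\<^sub>3\<close> suffice;
  \<^item> the cuspidal relation \<open>t_cubed\<^sup>2 = t_squared\<^sup>3\<close>, up to a constant factor the discriminant of the
    binary cubic with coefficients \<open>1, 3 N\<^sub>1, 3 N\<^sub>2, N\<^sub>3\<close>, is a combination of the quadrics for
    \<open>(2, 2), (2, 3), (3, 3)\<close> (\<open>negligible_cusp\<close>).

  So every polynomial in the \<open>N\<^sub>i\<close> is congruent to some
  \<open>a(u, t_squared) + b(u, t_squared) t_cubed\<close> (\<open>has_normal_form_peval_N\<close>). If it vanishes at the
  Pareto points, then \<open>a(u, t\<^sup>2) + b(u, t\<^sup>2) t\<^sup>3\<close> vanishes on an open set of real \<open>(u, t)\<close>, hence
  identically; its parts even and odd in \<open>t\<close> then vanish separately, so \<open>a = b = 0\<close>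
  (\<open>cuspidal_parametrization_injective\<close>). A polynomial in the \<open>M\<^sub>i\<close> becomes one in the
  \<open>N\<^sub>i\<close> after division by a power of \<open>M\<^sub>1 \<cdots> M\<^sub>d\<close>, which is what the saturation permits.

  The localisation at \<open>M\<^sub>1 \<cdots> M\<^sub>d\<close> is represented by functions on the torus where all coordinates
  are nonzero: a function belongs to the extension of an ideal if a power of the product of the
  coordinates carries it to the values of a member of that ideal (\<open>clears_into\<close>). The identity theorem for
  polynomials (\<open>identity_theorem\<close>) converts equalities of values back to equalities of polynomials.
\<close>

section \<open>Polynomials and substitution\<close>

abbreviation polys :: "nat set \<Rightarrow> cmpoly set"
  where "polys V \<equiv> carrier (mpoly_ring V)"

lemma mem_polys_iff:
  "p \<in> polys V \<longleftrightarrow> (\<forall>m\<in>Poly_Mapping.keys p. Poly_Mapping.keys m \<subseteq> V)"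
  by (simp add: mpoly_ring_def)

lemma mpoly_ring_simps [simp]:
  "monoid.mult (mpoly_ring V) = (*)" "one (mpoly_ring V) = 1"
  "zero (mpoly_ring V) = 0" "add (mpoly_ring V) = (+)"
  by (simp_all add: mpoly_ring_def)

lemma nat_pow_mpoly_ring [simp]: "p [^]\<^bsub>mpoly_ring V\<^esub> (k::nat) = p ^ k"
  by (induction k) (simp_all add: mult.commute)

lemma polys_zero [simp]: "0 \<in> polys V"
  and polys_one [simp]: "1 \<in> polys V"
  and polys_add [simp, intro]: "p \<in> polys V \<Longrightarrow> q \<in> polys V \<Longrightarrow> p + q \<in> polys V"
  and polys_mult [simp, intro]: "p \<in> polys V \<Longrightarrow> q \<in> polys V \<Longrightarrow> p * q \<in> polys V"
  using cring.axioms(1)[OF mpoly_ring_cring[of V], THEN ring.ring_simprules(2)]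
    cring.axioms(1)[OF mpoly_ring_cring[of V], THEN ring.ring_simprules(6)]
    cring.axioms(1)[OF mpoly_ring_cring[of V], THEN ring.ring_simprules(1)]
    cring.axioms(1)[OF mpoly_ring_cring[of V], THEN ring.ring_simprules(5)]
  by auto

lemma polys_uminus [simp, intro]: "p \<in> polys V \<Longrightarrow> - p \<in> polys V"
  by (simp add: mem_polys_iff)

lemma polys_diff [simp, intro]: "p \<in> polys V \<Longrightarrow> q \<in> polys V \<Longrightarrow> p - q \<in> polys V"
  using polys_add[OF _ polys_uminus, of p V q] by simp

lemma polys_power [simp, intro]: "p \<in> polys V \<Longrightarrow> p ^ n \<in> polys V"
  by (induction n) auto

lemma polys_sum [simp, intro]: "(\<And>i. i \<in> A \<Longrightarrow> f i \<in> polys V) \<Longrightarrow> sum f A \<in> polys V"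
  by (induction A rule: infinite_finite_induct) auto

lemma polys_prod [simp, intro]: "(\<And>i. i \<in> A \<Longrightarrow> f i \<in> polys V) \<Longrightarrow> prod f A \<in> polys V"
  by (induction A rule: infinite_finite_induct) auto

lemma polys_Const [simp]: "Const c \<in> polys V"
  by (simp add: mem_polys_iff Const_def)

lemma polys_Var [simp]: "Var i \<in> polys V \<longleftrightarrow> i \<in> V"
  by (simp add: mem_polys_iff Var_def)

lemma Const_simps: "Const 0 = 0" "Const 1 = 1" "Const (a + b) = Const a + Const b"
  "Const (a * b) = Const a * Const b"
  by (simp_all add: Const_def single_add mult_single)

lemma Const_of_nat: "Const (of_nat n) = of_nat n"
  by (simp add: Const_def)

lemma polys_of_nat [simp]: "of_nat n \<in> polys V"
  by (metis Const_of_nat polys_Const)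

lemma polys_numeral [simp]: "numeral n \<in> polys V"
  using polys_of_nat[of "numeral n" V] by simp

lemma poly_mapping_eq_sum_single:
  "p = (\<Sum>m\<in>Poly_Mapping.keys p. Poly_Mapping.single m (Poly_Mapping.lookup p m))"
  by (rule poly_mapping_eqI)
    (simp add: lookup_sum lookup_single when_def in_keys_iff)

lemma Var_power: "Var i ^ k = Poly_Mapping.single (Poly_Mapping.single i k) 1"
  by (induction k) (simp_all add: Var_def mult_single flip: single_add)

lemma single_eq_prod_Var:
  "Poly_Mapping.single m c =
    Const c * (\<Prod>i\<in>Poly_Mapping.keys m. Var i ^ Poly_Mapping.lookup m i)"
proof -
  have "(\<Prod>i\<in>F. Var i ^ Poly_Mapping.lookup m i) =
      Poly_Mapping.single (\<Sum>i\<in>F. Poly_Mapping.single i (Poly_Mapping.lookup m i)) 1"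
    if "finite F" for F
    using that by induction (simp_all add: Var_power mult_single)
  from this[of "Poly_Mapping.keys m"] show ?thesis
    using poly_mapping_eq_sum_single[of m] by (simp add: Const_def mult_single)
qed

text \<open>Many statements below hold for all polynomials because they hold for constants and variables and
  survive sums and products; this rule spares every one of them the passage to coefficients.\<close>

lemma cmpoly_induct [consumes 1, case_names Const Var add mult]:
  assumes p: "p \<in> polys V"
    and Const: "\<And>c. P (Const c)" and Var: "\<And>i. i \<in> V \<Longrightarrow> P (Var i)"
    and add: "\<And>p q. p \<in> polys V \<Longrightarrow> q \<in> polys V \<Longrightarrow> P p \<Longrightarrow> P q \<Longrightarrow> P (p + q)"
    and mult: "\<And>p q. p \<in> polys V \<Longrightarrow> q \<in> polys V \<Longrightarrow> P p \<Longrightarrow> P q \<Longrightarrow> P (p * q)"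
  shows "P p"
proof -
  define Q where "Q r \<longleftrightarrow> r \<in> polys V \<and> P r" for r
  have Qc: "Q (Const c)" for c using Const by (simp add: Q_def)
  have Qm: "Q (r * s)" if "Q r" "Q s" for r s using that mult by (auto simp: Q_def)
  have Qpow: "Q (Var i ^ k)" if "i \<in> V" for i k
    using that Qc[of 1] by (induction k) (auto simp: Const_simps Q_def Var mult)
  have Qprod: "Q (prod f F)" if "\<And>i. i \<in> F \<Longrightarrow> Q (f i)" "finite F" for f :: "nat \<Rightarrow> _" and F
    using that(2,1) Qc[of 1] by induction (auto simp: Const_simps Qm)
  have Qsingle: "Q (Poly_Mapping.single m c)" if "Poly_Mapping.keys m \<subseteq> V" for m c
    unfolding single_eq_prod_Var using that by (intro Qm Qc Qprod Qpow) auto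
  have Qsum: "Q (sum f F)" if "\<And>i. i \<in> F \<Longrightarrow> Q (f i)" "finite F"
    for f :: "(nat \<Rightarrow>\<^sub>0 nat) \<Rightarrow> _" and F
    using that(2,1) Qc[of 0] by induction (auto simp: Const_simps Q_def add)
  have "Q p"
    by (subst poly_mapping_eq_sum_single) (use p in \<open>auto intro!: Qsum Qsingle simp: mem_polys_iff\<close>)
  then show ?thesis by (simp add: Q_def)
qed

lemma cmpoly_UNIV: "p \<in> polys UNIV"
  by (simp add: mem_polys_iff)

text \<open>Substitution is used both for evaluation at complex points and for composition of polynomials;
  what makes it a ring homomorphism is only that the embedding of the coefficients is one.\<close>

locale coeff_hom =
  fixes h :: "complex \<Rightarrow> 'b::comm_ring_1"
  assumes h_zero: "h 0 = 0" and h_one: "h 1 = 1"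
    and h_add: "h (a + b) = h a + h b" and h_mult: "h (a * b) = h a * h b"
begin

lemma subst_eval_superset:
  assumes "finite A" "Poly_Mapping.keys p \<subseteq> A"
  shows "subst_eval h x p = (\<Sum>m\<in>A. h (Poly_Mapping.lookup p m) *
      (\<Prod>i\<in>Poly_Mapping.keys m. x i ^ Poly_Mapping.lookup m i))"
  unfolding subst_eval_def using assms
  by (intro sum.mono_neutral_left) (auto simp: h_zero in_keys_iff)

lemma subst_eval_add [simp]: "subst_eval h x (p + q) = subst_eval h x p + subst_eval h x q"
proof -
  let ?A = "Poly_Mapping.keys p \<union> Poly_Mapping.keys q"
  show ?thesis
    by (simp add: subst_eval_superset[of ?A] keys_add lookup_add h_add
        distrib_right sum.distrib)
qed

lemma subst_eval_single [simp]: "subst_eval h x (Poly_Mapping.single m c) =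
    h c * (\<Prod>i\<in>Poly_Mapping.keys m. x i ^ Poly_Mapping.lookup m i)"
  by (subst subst_eval_superset[of "{m}"]) auto

lemma subst_eval_Const [simp]: "subst_eval h x (Const c) = h c"
  by (simp add: Const_def)

lemma subst_eval_zero [simp]: "subst_eval h x 0 = 0"
  by (simp add: subst_eval_def)

lemma subst_eval_one [simp]: "subst_eval h x 1 = 1"
  using subst_eval_Const[of x 1] by (simp add: Const_simps h_one)

lemma subst_eval_Var [simp]: "subst_eval h x (Var i) = x i"
  by (simp add: Var_def h_one)

lemma subst_eval_sum [simp]: "subst_eval h x (sum f A) = (\<Sum>i\<in>A. subst_eval h x (f i))"
  by (induction A rule: infinite_finite_induct) auto

lemma subst_eval_mult [simp]: "subst_eval h x (p * q) = subst_eval h x p * subst_eval h x q"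
proof -
  let ?v = "\<lambda>m. \<Prod>i\<in>Poly_Mapping.keys m. x i ^ Poly_Mapping.lookup m i"
  have v: "?v m = (\<Prod>i\<in>A. x i ^ Poly_Mapping.lookup m i)"
    if "finite A" "Poly_Mapping.keys m \<subseteq> A" for m A
    using that by (intro prod.mono_neutral_left) (auto simp: in_keys_iff)
  have v_add: "?v (m + n) = ?v m * ?v n" for m n
  proof -
    let ?A = "Poly_Mapping.keys m \<union> Poly_Mapping.keys n"
    show ?thesis
      unfolding v[of ?A "m + n", OF _ Poly_Mapping.keys_add, simplified]
        v[of ?A m, OF _ Un_upper1, simplified] v[of ?A n, OF _ Un_upper2, simplified]
      by (simp add: lookup_add power_add prod.distrib)
  qed
  have single: "subst_eval h x (Poly_Mapping.single m a * Poly_Mapping.single n b) =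
      subst_eval h x (Poly_Mapping.single m a) * subst_eval h x (Poly_Mapping.single n b)"
    for m n a b
    by (simp add: mult_single h_mult v_add mult_ac)
  show ?thesis
    by (subst (1 2 3 4) poly_mapping_eq_sum_single)
      (simp only: sum_product subst_eval_sum single)
qed

lemma subst_eval_power [simp]: "subst_eval h x (p ^ n) = subst_eval h x p ^ n"
  by (induction n) auto

lemma subst_eval_prod [simp]: "subst_eval h x (prod f A) = (\<Prod>i\<in>A. subst_eval h x (f i))"
  by (induction A rule: infinite_finite_induct) auto

lemma subst_eval_of_nat [simp]: "subst_eval h x (of_nat n) = of_nat n"
  by (induction n) auto

lemma subst_eval_numeral [simp]: "subst_eval h x (numeral n) = numeral n"
  using subst_eval_of_nat[of x "numeral n"] by simp

lemma subst_eval_uminus [simp]: "subst_eval h x (- p) = - subst_eval h x p"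
  using subst_eval_add[of x p "- p"] by (simp add: add_eq_0_iff)

lemma subst_eval_diff [simp]: "subst_eval h x (p - q) = subst_eval h x p - subst_eval h x q"
  using subst_eval_add[of x p "- q"] by simp

lemma subst_eval_cong:
  assumes "p \<in> polys V" "\<And>i. i \<in> V \<Longrightarrow> x i = y i"
  shows "subst_eval h x p = subst_eval h y p"
  using assms(1) by (induction rule: cmpoly_induct) (auto simp: assms(2))

end

interpretation peval: coeff_hom "\<lambda>c::complex. c"
  by standard auto

interpretation Const: coeff_hom Const
  by standard (auto simp: Const_simps)

lemma peval_subst: "peval (subst_eval Const y p) x = peval p (\<lambda>i. peval (y i) x)"
  using cmpoly_UNIV[of p] by (induction rule: cmpoly_induct) auto

lemma subst_in_polys:
  assumes "p \<in> polys V" "\<And>i. i \<in> V \<Longrightarrow> y i \<in> polys W"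
  shows "subst_eval Const y p \<in> polys W"
  using assms(1) by (induction rule: cmpoly_induct) (auto simp: assms(2))

section \<open>The identity theorem\<close>

text \<open>Splitting off one variable, as needed for the induction in the identity theorem. Univariate
  polynomials with polynomial coefficients are used as certificates since their coefficients
  behave well under sums and products.\<close>

lemma polys_insert_as_univariate:
  assumes "p \<in> polys (insert v V)"
  shows "\<exists>c :: cmpoly poly. (\<forall>k. coeff c k \<in> polys V) \<and> p = poly c (Var v)"
  using assms
proof (induction rule: cmpoly_induct)
  case (Const a)
  show ?case by (intro exI[of _ "[:Const a:]"]) (auto simp: coeff_pCons split: nat.split)
next
  case (Var i)
  show ?case
  proof (cases "i = v")
    case True
    then show ?thesis
      by (intro exI[of _ "[:0, 1:]"]) (auto simp: coeff_pCons split: nat.split)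
  next
    case False
    with Var show ?thesis
      by (intro exI[of _ "[:Var i:]"]) (auto simp: coeff_pCons split: nat.split)
  qed
next
  case (add p q)
  then obtain c e where "\<forall>k. coeff c k \<in> polys V" "p = poly c (Var v)"
    "\<forall>k. coeff e k \<in> polys V" "q = poly e (Var v)" by blast
  then show ?case by (intro exI[of _ "c + e"]) auto
next
  case (mult p q)
  then obtain c e where "\<forall>k. coeff c k \<in> polys V" "p = poly c (Var v)"
    "\<forall>k. coeff e k \<in> polys V" "q = poly e (Var v)" by blast
  then show ?case by (intro exI[of _ "c * e"]) (auto simp: coeff_mult)
qed

text \<open>Induction on the variables: at a fixed value of the others, the polynomial in the last variable
  has infinitely many roots, so its coefficients vanish at that value.\<close>

lemma identity_theorem:
  assumes "finite V" "p \<in> polys V" "\<And>i. i \<in> V \<Longrightarrow> infinite (A i)"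
    and "\<And>x. (\<And>i. i \<in> V \<Longrightarrow> x i \<in> A i) \<Longrightarrow> peval p x = 0"
  shows "p = 0"
  using assms
proof (induction V arbitrary: p)
  case empty
  have "p = Const (peval p (\<lambda>_. 0))"
    using empty(1) by (induction rule: cmpoly_induct) (auto simp: Const_simps)
  with empty(3) show ?case by (simp add: Const_simps)
next
  case (insert v V)
  obtain c where c: "\<And>k. coeff c k \<in> polys V" and p: "p = poly c (Var v)"
    using polys_insert_as_univariate[OF insert.prems(1)] by blast
  have "coeff c k = 0" for k
  proof (rule insert.IH[OF c])
    show "infinite (A i)" if "i \<in> V" for i using insert.prems(2) that by blast
    fix x assume x: "\<And>i. i \<in> V \<Longrightarrow> x i \<in> A i"
    define q where "q = (\<Sum>k\<le>degree c. monom (peval (coeff c k) x) k)"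
    have "poly q t = 0" if "t \<in> A v" for t
    proof -
      have "peval (coeff c k) (x(v := t)) = peval (coeff c k) x" for k
        using insert.hyps(2) by (intro peval.subst_eval_cong[OF c]) auto
      then have "poly q t = peval p (x(v := t))"
        by (simp add: q_def p poly_sum poly_monom poly_altdef[of c])
      also have "\<dots> = 0"
        using x that insert.hyps(2) by (intro insert.prems(3)) auto
      finally show ?thesis .
    qed
    then have "A v \<subseteq> {t. poly q t = 0}" by auto
    with insert.prems(2)[of v] have "q = 0"
      using poly_roots_finite finite_subset by blast
    then have "coeff q k = 0" by simp
    then show "peval (coeff c k) x = 0"
      by (cases "k \<le> degree c") (auto simp: q_def coeff_sum coeff_eq_0)
  qed
  then show ?case by (simp add: p poly_altdef)
qed

lemma ideal_mpoly_ringI: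
  assumes "I \<subseteq> polys V" "0 \<in> I" "\<And>p q. p \<in> I \<Longrightarrow> q \<in> I \<Longrightarrow> p + q \<in> I"
    and "\<And>p q. p \<in> I \<Longrightarrow> q \<in> polys V \<Longrightarrow> p * q \<in> I"
  shows "ideal I (mpoly_ring V)"
proof (rule idealI)
  interpret cring "mpoly_ring V" by (rule mpoly_ring_cring)
  show "ring (mpoly_ring V)" by (rule ring_axioms)
  have inv: "\<ominus>\<^bsub>mpoly_ring V\<^esub> p = - p" if "p \<in> polys V" for p
    using that polys_uminus by (intro minus_equality) auto
  show "subgroup I (add_monoid (mpoly_ring V))"
  proof (rule add.subgroupI)
    show "\<ominus>\<^bsub>mpoly_ring V\<^esub> p \<in> I" if "p \<in> I" for p
      using assms(4)[OF that polys_uminus[OF polys_one]] that assms(1) by (auto simp: inv)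
  qed (use assms in auto)
qed (use assms in \<open>auto simp: mult.commute\<close>)

lemma ideal_mpoly_ringD:
  assumes "ideal I (mpoly_ring V)"
  shows "I \<subseteq> polys V" "0 \<in> I" "p \<in> I \<Longrightarrow> q \<in> I \<Longrightarrow> p + q \<in> I"
    "p \<in> I \<Longrightarrow> q \<in> polys V \<Longrightarrow> p * q \<in> I"
proof -
  interpret ideal I "mpoly_ring V" by fact
  show "I \<subseteq> polys V" by (rule a_subset)
  show "0 \<in> I" using additive_subgroup.zero_closed[OF is_additive_subgroup] by simp
  show "p + q \<in> I" if "p \<in> I" "q \<in> I" using additive_subgroup.a_closed[OF is_additive_subgroup that] by simp
  show "p * q \<in> I" if "p \<in> I" "q \<in> polys V" using I_r_closed[OF that] by simp
qed

lemma ideal_vanishing: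
  "ideal {f \<in> polys V. \<forall>x\<in>X. peval f x = 0} (mpoly_ring V)"
  by (rule ideal_mpoly_ringI) auto

lemma genideal_vanishing:
  assumes "S \<subseteq> polys V" "\<And>f x. f \<in> S \<Longrightarrow> x \<in> X \<Longrightarrow> peval f x = 0"
    and "f \<in> Idl\<^bsub>mpoly_ring V\<^esub> S" "x \<in> X"
  shows "f \<in> polys V" "peval f x = 0"
proof -
  interpret cring "mpoly_ring V" by (rule mpoly_ring_cring)
  have "Idl\<^bsub>mpoly_ring V\<^esub> S \<subseteq> {f \<in> polys V. \<forall>x\<in>X. peval f x = 0}"
    by (rule genideal_minimal[OF ideal_vanishing]) (use assms(1,2) in auto)
  with assms(3,4) show "f \<in> polys V" "peval f x = 0" by auto
qed

section \<open>The affine Pareto moment ideal as a vanishing ideal\<close>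

definition pareto_point :: "nat \<Rightarrow> real \<Rightarrow> real \<Rightarrow> nat \<Rightarrow> complex"
  where "pareto_point d \<alpha> \<xi> = (\<lambda>i. if i \<le> d then of_real (pareto_moment \<alpha> \<xi> i) else 0)"

definition pareto_points :: "nat \<Rightarrow> (nat \<Rightarrow> complex) set"
  where "pareto_points d = {pareto_point d \<alpha> \<xi> | \<alpha> \<xi>. \<alpha> > real d \<and> \<xi> > 0}"

lemma pareto_points_zero: "x \<in> pareto_points d \<Longrightarrow> x 0 = 1"
  by (auto simp: pareto_points_def pareto_point_def pareto_moment_def)

lemma pareto_points_nonzero:
  assumes "x \<in> pareto_points d" "i \<le> d"
  shows "x i \<noteq> 0"
proof -
  obtain \<alpha> \<xi> where "x = pareto_point d \<alpha> \<xi>" "\<alpha> > real d" "\<xi> > 0"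
    using assms(1) by (auto simp: pareto_points_def)
  moreover from this assms(2) have "\<alpha> > real i" by linarith
  ultimately have "pareto_moment \<alpha> \<xi> i > 0"
    by (simp add: pareto_moment_def)
  then show ?thesis
    using assms(2) \<open>x = _\<close> by (simp add: pareto_point_def)
qed

definition homogeneous_of_degree :: "nat \<Rightarrow> cmpoly \<Rightarrow> bool"
  where "homogeneous_of_degree n p \<longleftrightarrow>
    (\<forall>m\<in>Poly_Mapping.keys p. (\<Sum>i\<in>Poly_Mapping.keys m. Poly_Mapping.lookup m i) = n)"

lemma sum_lookup_add:
  fixes m n :: "nat \<Rightarrow>\<^sub>0 nat"
  shows "(\<Sum>i\<in>Poly_Mapping.keys (m + n). Poly_Mapping.lookup (m + n) i) =
    (\<Sum>i\<in>Poly_Mapping.keys m. Poly_Mapping.lookup m i) +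
    (\<Sum>i\<in>Poly_Mapping.keys n. Poly_Mapping.lookup n i)"
proof -
  let ?A = "Poly_Mapping.keys m \<union> Poly_Mapping.keys n"
  have ext: "(\<Sum>i\<in>Poly_Mapping.keys k. Poly_Mapping.lookup k i) =
      (\<Sum>i\<in>?A. Poly_Mapping.lookup k i)" if "Poly_Mapping.keys k \<subseteq> ?A"
    for k :: "nat \<Rightarrow>\<^sub>0 nat"
    using that by (intro sum.mono_neutral_left) (auto simp: in_keys_iff)
  show ?thesis
    unfolding ext[OF Poly_Mapping.keys_add] ext[OF Un_upper1] ext[OF Un_upper2]
    by (simp add: lookup_add sum.distrib)
qed

lemma homogeneous_of_degree_add:
  "homogeneous_of_degree n p \<Longrightarrow> homogeneous_of_degree n q \<Longrightarrow> homogeneous_of_degree n (p + q)"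
  using Poly_Mapping.keys_add[of p q] by (auto simp: homogeneous_of_degree_def)

lemma homogeneous_of_degree_mult:
  assumes "homogeneous_of_degree m p" "homogeneous_of_degree n q"
  shows "homogeneous_of_degree (m + n) (p * q)"
  unfolding homogeneous_of_degree_def
proof
  fix k assume "k \<in> Poly_Mapping.keys (p * q)"
  then obtain a b where "a \<in> Poly_Mapping.keys p" "b \<in> Poly_Mapping.keys q" "k = a + b"
    using keys_mult[of p q] by blast
  then show "(\<Sum>i\<in>Poly_Mapping.keys k. Poly_Mapping.lookup k i) = m + n"
    using assms by (simp add: homogeneous_of_degree_def sum_lookup_add)
qed

lemma homogeneous_of_degree_Const: "homogeneous_of_degree 0 (Const c)"
  by (simp add: homogeneous_of_degree_def Const_def)

lemma homogeneous_of_degree_Var: "homogeneous_of_degree 1 (Var i)"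
  by (simp add: homogeneous_of_degree_def Var_def)

lemma homogeneous_of_degree_Var_power: "homogeneous_of_degree n (Var i ^ n)"
  by (simp add: homogeneous_of_degree_def Var_power)

lemma peval_homogeneous_scale:
  assumes "homogeneous_of_degree n p"
  shows "peval p (\<lambda>i. c * x i) = c ^ n * peval p x"
  unfolding subst_eval_def sum_distrib_left
proof (rule sum.cong)
  fix m assume "m \<in> Poly_Mapping.keys p"
  with assms show "Poly_Mapping.lookup p m *
      (\<Prod>i\<in>Poly_Mapping.keys m. (c * x i) ^ Poly_Mapping.lookup m i) =
    c ^ n * (Poly_Mapping.lookup p m *
      (\<Prod>i\<in>Poly_Mapping.keys m. x i ^ Poly_Mapping.lookup m i))"
    by (simp add: homogeneous_of_degree_def power_mult_distrib prod.distrib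
        flip: power_sum)
qed simp

lemma dehomogenize_simps [simp]:
  "dehomogenize (Const c) = Const c" "dehomogenize (Var i) = M i"
  "dehomogenize (p + q) = dehomogenize p + dehomogenize q"
  "dehomogenize (p * q) = dehomogenize p * dehomogenize q"
  "dehomogenize (p ^ n) = dehomogenize p ^ n"
  by (simp_all add: dehomogenize_def)

lemma dehomogenize_in_polys: "p \<in> polys {0..d} \<Longrightarrow> dehomogenize p \<in> polys {1..d}"
  unfolding dehomogenize_def by (rule subst_in_polys) (auto simp: M_def)

lemma peval_dehomogenize: "x 0 = 1 \<Longrightarrow> peval (dehomogenize p) x = peval p x"
  unfolding dehomogenize_def peval_subst
  by (rule peval.subst_eval_cong[OF cmpoly_UNIV]) (simp add: M_def)

text \<open>Homogenizations are needed in every large degree, because the summands of a sum have to be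
  lifted to a common degree.\<close>

lemma exists_homogenization:
  assumes "f \<in> polys {1..d}"
  shows "\<exists>N. \<forall>n\<ge>N. \<exists>F\<in>polys {0..d}. homogeneous_of_degree n F \<and> dehomogenize F = f"
  using assms
proof (induction rule: cmpoly_induct)
  case (Const c)
  show ?case
  proof (intro exI[of _ 0] allI impI bexI conjI)
    fix n show "homogeneous_of_degree n (Const c * Var 0 ^ n)"
      using homogeneous_of_degree_mult[OF homogeneous_of_degree_Const
          homogeneous_of_degree_Var_power] by simp
  qed (auto simp: M_def)
next
  case (Var i)
  show ?case
  proof (intro exI[of _ 1] allI impI bexI conjI)
    fix n :: nat assume "n \<ge> 1"
    then show "homogeneous_of_degree n (Var i * Var 0 ^ (n - 1))"
      using homogeneous_of_degree_mult[OF homogeneous_of_degree_Var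
          homogeneous_of_degree_Var_power[of "n - 1"]] by simp
  qed (use Var in \<open>auto simp: M_def\<close>)
next
  case (add p q)
  then obtain N1 N2 where N:
    "\<And>n. n \<ge> N1 \<Longrightarrow> \<exists>F\<in>polys {0..d}. homogeneous_of_degree n F \<and> dehomogenize F = p"
    "\<And>n. n \<ge> N2 \<Longrightarrow> \<exists>F\<in>polys {0..d}. homogeneous_of_degree n F \<and> dehomogenize F = q"
    by blast
  show ?case
  proof (intro exI[of _ "max N1 N2"] allI impI)
    fix n assume "n \<ge> max N1 N2"
    then obtain F G where "F \<in> polys {0..d}" "homogeneous_of_degree n F" "dehomogenize F = p"
      "G \<in> polys {0..d}" "homogeneous_of_degree n G" "dehomogenize G = q"
      using N by (meson max.boundedE)
    then show "\<exists>F\<in>polys {0..d}. homogeneous_of_degree n F \<and> dehomogenize F = p + q"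
      by (intro bexI[of _ "F + G"]) (auto intro: homogeneous_of_degree_add)
  qed
next
  case (mult p q)
  then obtain N1 N2 where N:
    "\<And>n. n \<ge> N1 \<Longrightarrow> \<exists>F\<in>polys {0..d}. homogeneous_of_degree n F \<and> dehomogenize F = p"
    "\<And>n. n \<ge> N2 \<Longrightarrow> \<exists>F\<in>polys {0..d}. homogeneous_of_degree n F \<and> dehomogenize F = q"
    by blast
  show ?case
  proof (intro exI[of _ "N1 + N2"] allI impI)
    fix n assume n: "n \<ge> N1 + N2"
    then have "n - N1 \<ge> N2" by simp
    with N obtain F G where "F \<in> polys {0..d}" "homogeneous_of_degree N1 F"
      "dehomogenize F = p" "G \<in> polys {0..d}" "homogeneous_of_degree (n - N1) G"
      "dehomogenize G = q"
      by (meson order_refl)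
    then show "\<exists>F\<in>polys {0..d}. homogeneous_of_degree n F \<and> dehomogenize F = p * q"
      using n homogeneous_of_degree_mult[of N1 F "n - N1" G]
      by (intro bexI[of _ "F * G"]) auto
  qed
qed

text \<open>The projective points of the definition, represented by the coordinate vectors with \<open>x\<^sub>0 = 1\<close>, at
  which a form and its dehomogenization agree.\<close>

lemma pareto_variety_alt:
  "pareto_variety d = zariski_closed d hull ((\<lambda>x. proportional d `` {x}) ` pareto_points d)"
proof -
  have "proj_point d (\<lambda>i. of_real (pareto_moment \<alpha> \<xi> i)) =
      proportional d `` {pareto_point d \<alpha> \<xi>}" for \<alpha> \<xi>
    by (simp add: proj_point_def pareto_point_def if_distrib cong: if_cong)
  then have "{proj_point d (\<lambda>i. of_real (pareto_moment \<alpha> \<xi> i)) | \<alpha> \<xi>. \<alpha> > real d \<and> \<xi> > 0} =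
      (\<lambda>x. proportional d `` {x}) ` pareto_points d"
    unfolding pareto_points_def by auto
  then show ?thesis by (simp add: pareto_variety_def)
qed

lemma pareto_points_nonzero_vecs: "x \<in> pareto_points d \<Longrightarrow> x \<in> nonzero_vecs d"
  using pareto_points_zero[of x d]
  by (auto simp: nonzero_vecs_def pareto_points_def pareto_point_def intro!: exI[of _ 0])

text \<open>Passing to the Zariski closure adds no condition: the zero set of a form is closed.\<close>

lemma vanishes_on_pareto_variety_iff:
  assumes F: "F \<in> polys {0..d}" "homogeneous F"
  shows "(\<forall>P\<in>pareto_variety d. vanishes_at F P) \<longleftrightarrow> (\<forall>x\<in>pareto_points d. peval F x = 0)"
proof
  assume van: "\<forall>P\<in>pareto_variety d. vanishes_at F P"
  show "\<forall>x\<in>pareto_points d. peval F x = 0"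
  proof
    fix x assume x: "x \<in> pareto_points d"
    then have "proportional d `` {x} \<in> pareto_variety d"
      unfolding pareto_variety_alt by (intro hull_inc) blast
    moreover have "x \<in> proportional d `` {x}"
      using pareto_points_nonzero_vecs[OF x]
      by (auto simp: proportional_def intro!: exI[of _ 1])
    ultimately show "peval F x = 0" using van by (auto simp: vanishes_at_def)
  qed
next
  assume van: "\<forall>x\<in>pareto_points d. peval F x = 0"
  define Z where "Z = {P \<in> proj_space d. \<forall>f\<in>{F}. vanishes_at f P}"
  have "zariski_closed d Z"
    unfolding zariski_closed_def Z_def by (intro exI[of _ "{F}"]) (use F in simp)
  obtain n where n: "homogeneous_of_degree n F"
    using F(2) by (auto simp: homogeneous_def homogeneous_of_degree_def)
  have "(\<lambda>x. proportional d `` {x}) ` pareto_points d \<subseteq> Z"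
  proof clarify
    fix x assume x: "x \<in> pareto_points d"
    have "vanishes_at F (proportional d `` {x})"
      using bspec[OF van x]
      by (auto simp: vanishes_at_def proportional_def peval_homogeneous_scale[OF n])
    then show "proportional d `` {x} \<in> Z"
      using pareto_points_nonzero_vecs[OF x]
      by (auto simp: Z_def proj_space_def intro: quotientI)
  qed
  then have "pareto_variety d \<subseteq> Z"
    unfolding pareto_variety_alt using \<open>zariski_closed d Z\<close> by (rule hull_minimal)
  then show "\<forall>P\<in>pareto_variety d. vanishes_at F P" by (auto simp: Z_def)
qed

text \<open>Forms and their dehomogenizations agree at vectors with \<open>x\<^sub>0 = 1\<close>, which gives one inclusion; for
  the other, a homogenization of a polynomial vanishing at the Pareto points is one of the forms
  generating the vanishing ideal.\<close>

lemma affine_pareto_moment_ideal_eq: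
  "affine_pareto_moment_ideal d = {f \<in> polys {1..d}. \<forall>x\<in>pareto_points d. peval f x = 0}"
proof -
  interpret cring "mpoly_ring {0..d}" by (rule mpoly_ring_cring)
  let ?S = "{f \<in> polys {0..d}. homogeneous f \<and> (\<forall>P\<in>pareto_variety d. vanishes_at f P)}"
  show ?thesis
  proof (intro equalityI subsetI)
    fix f assume "f \<in> affine_pareto_moment_ideal d"
    then obtain p where p: "p \<in> Idl\<^bsub>mpoly_ring {0..d}\<^esub> ?S" "f = dehomogenize p"
      by (auto simp: affine_pareto_moment_ideal_def vanishing_ideal_def)
    have S: "?S \<subseteq> polys {0..d}" by blast
    have "p \<in> polys {0..d}"
      using ideal_mpoly_ringD(1)[OF genideal_ideal[OF S]] p(1) by blast
    moreover have "peval p x = 0" if "x \<in> pareto_points d" for x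
      by (rule genideal_vanishing[OF S _ p(1) that])
        (use vanishes_on_pareto_variety_iff in blast)
    ultimately show "f \<in> {f \<in> polys {1..d}. \<forall>x\<in>pareto_points d. peval f x = 0}"
      using dehomogenize_in_polys[of p d]
      by (auto simp: p(2) peval_dehomogenize pareto_points_zero)
  next
    fix f assume "f \<in> {f \<in> polys {1..d}. \<forall>x\<in>pareto_points d. peval f x = 0}"
    then have f: "f \<in> polys {1..d}" "\<And>x. x \<in> pareto_points d \<Longrightarrow> peval f x = 0" by auto
    obtain n F where F: "F \<in> polys {0..d}" "homogeneous_of_degree n F" "dehomogenize F = f"
      using exists_homogenization[OF f(1)] by blast
    have hom: "homogeneous F"
      using F(2) by (auto simp: homogeneous_def homogeneous_of_degree_def)
    have "peval F x = 0" if "x \<in> pareto_points d" for x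
      using f(2)[OF that] peval_dehomogenize[of x F, OF pareto_points_zero[OF that]] F(3) by simp
    then have "F \<in> ?S"
      using F(1) hom vanishes_on_pareto_variety_iff by blast
    then have "F \<in> vanishing_ideal d (pareto_variety d)"
      using genideal_self[of ?S] by (auto simp: vanishing_ideal_def)
    then show "f \<in> affine_pareto_moment_ideal d"
      using F(3) by (auto simp: affine_pareto_moment_ideal_def)
  qed
qed

text \<open>Index sets are written \<open>{1..d}\<close> throughout; rewriting \<open>1\<close> to \<open>Suc 0\<close> would keep the simplifier
  from recognising them.\<close>

declare One_nat_def [simp del]

section \<open>Functions on the torus, up to denominators\<close>

definition torus :: "nat \<Rightarrow> (nat \<Rightarrow> complex) set"
  where "torus d = {x. \<forall>i\<in>{1..d}. x i \<noteq> 0}"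

text \<open>For an ideal \<open>I\<close> this is membership in the extension of \<open>I\<close> to the localisation at the product of
  the coordinates, the elements of the localisation being viewed as functions on the torus.\<close>

definition clears_into :: "nat \<Rightarrow> cmpoly set \<Rightarrow> ((nat \<Rightarrow> complex) \<Rightarrow> complex) \<Rightarrow> bool"
  where "clears_into d I \<phi> \<longleftrightarrow>
    (\<exists>k. \<exists>r\<in>I. \<forall>x\<in>torus d. peval r x = (\<Prod>i=1..d. x i) ^ k * \<phi> x)"

lemma clears_intoI:
  assumes "r \<in> I" "\<And>x. x \<in> torus d \<Longrightarrow> peval r x = (\<Prod>i=1..d. x i) ^ k * \<phi> x"
  shows "clears_into d I \<phi>"
  using assms unfolding clears_into_def by blast

lemma clears_into_cong:
  assumes "clears_into d I \<phi>" "\<And>x. x \<in> torus d \<Longrightarrow> \<psi> x = \<phi> x"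
  shows "clears_into d I \<psi>"
  using assms unfolding clears_into_def by simp

lemma clears_into_mono: "clears_into d I \<phi> \<Longrightarrow> I \<subseteq> K \<Longrightarrow> clears_into d K \<phi>"
  unfolding clears_into_def by blast

lemma M_in_polys: "i \<le> d \<Longrightarrow> M i \<in> polys {1..d}"
  by (simp add: M_def)

lemma peval_M: "peval (M i) x = (if i = 0 then 1 else x i)"
  by (simp add: M_def)

lemma prod_Var_in_polys: "(\<Prod>i=1..d. Var i) \<in> polys {1..d}"
  by (rule polys_prod) auto

lemma polys_ideal: "ideal (polys V) (mpoly_ring V)"
  by (rule ideal_mpoly_ringI) auto

lemma clears_into_mult:
  assumes I: "ideal I (mpoly_ring {1..d})"
    and \<phi>: "clears_into d I \<phi>" and \<psi>: "clears_into d (polys {1..d}) \<psi>"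
  shows "clears_into d I (\<lambda>x. \<phi> x * \<psi> x)"
proof -
  from \<phi> obtain r k where r: "r \<in> I"
    "\<And>x. x \<in> torus d \<Longrightarrow> peval r x = (\<Prod>i=1..d. x i) ^ k * \<phi> x"
    unfolding clears_into_def by blast
  from \<psi> obtain s l where s: "s \<in> polys {1..d}"
    "\<And>x. x \<in> torus d \<Longrightarrow> peval s x = (\<Prod>i=1..d. x i) ^ l * \<psi> x"
    unfolding clears_into_def by blast
  show ?thesis
  proof (rule clears_intoI[where k = "k + l"])
    show "r * s \<in> I" using ideal_mpoly_ringD(4)[OF I r(1) s(1)] .
  qed (simp add: r(2) s(2) power_add)
qed

lemma clears_into_add:
  assumes I: "ideal I (mpoly_ring {1..d})"
    and \<phi>: "clears_into d I \<phi>" and \<psi>: "clears_into d I \<psi>"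
  shows "clears_into d I (\<lambda>x. \<phi> x + \<psi> x)"
proof -
  let ?g = "\<Prod>i=1..d. Var i"
  from \<phi> obtain r k where r: "r \<in> I"
    "\<And>x. x \<in> torus d \<Longrightarrow> peval r x = (\<Prod>i=1..d. x i) ^ k * \<phi> x"
    unfolding clears_into_def by blast
  from \<psi> obtain s l where s: "s \<in> I"
    "\<And>x. x \<in> torus d \<Longrightarrow> peval s x = (\<Prod>i=1..d. x i) ^ l * \<psi> x"
    unfolding clears_into_def by blast
  show ?thesis
  proof (rule clears_intoI[where k = "k + l"])
    show "r * ?g ^ l + s * ?g ^ k \<in> I"
      by (intro ideal_mpoly_ringD(3,4)[OF I] r(1) s(1) polys_power prod_Var_in_polys)
  qed (simp add: r(2) s(2) power_add algebra_simps)
qed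

lemma clears_into_peval:
  assumes "p \<in> I"
  shows "clears_into d I (\<lambda>x. peval p x)"
  by (rule clears_intoI[OF assms, where k = 0]) simp

lemma clears_into_zero: "ideal I (mpoly_ring {1..d}) \<Longrightarrow> clears_into d I (\<lambda>_. 0)"
  using clears_into_peval[of 0 I d] ideal_mpoly_ringD(2) by simp

abbreviation regular :: "nat \<Rightarrow> ((nat \<Rightarrow> complex) \<Rightarrow> complex) \<Rightarrow> bool"
  where "regular d \<equiv> clears_into d (polys {1..d})"

lemma regular_const: "regular d (\<lambda>_. c)"
  using clears_into_peval[OF polys_Const[of c "{1..d}"], of d] by simp

lemmas regular_add = clears_into_add[OF polys_ideal]
  and regular_mult = clears_into_mult[OF polys_ideal]

lemma regular_diff:
  assumes "regular d \<phi>" "regular d \<psi>"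
  shows "regular d (\<lambda>x. \<phi> x - \<psi> x)"
  using regular_add[OF assms(1) regular_mult[OF regular_const[of d "-1"] assms(2)]] by simp

lemma regular_power: "regular d \<phi> \<Longrightarrow> regular d (\<lambda>x. \<phi> x ^ n)"
  by (induction n) (auto intro: regular_mult regular_const)

lemma regular_peval_comp:
  assumes "\<And>i. regular d (\<lambda>x. \<eta> x i)"
  shows "regular d (\<lambda>x. peval p (\<eta> x))"
  using cmpoly_UNIV[of p]
  by (induction rule: cmpoly_induct) (auto intro: regular_add regular_mult regular_const assms)

section \<open>Inverse moments\<close>

text \<open>The variable of index 0 is specialised to 1, so \<open>N\<^sub>0 = 1\<close>, and the quadrics below become uniform
  in their indices.\<close>

definition N :: "nat \<Rightarrow> (nat \<Rightarrow> complex) \<Rightarrow> complex"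
  where "N i x = inverse (peval (M i) x)"

lemma N_zero [simp]: "N 0 x = 1"
  by (simp add: N_def peval_M)

lemma peval_M_N: "x \<in> torus d \<Longrightarrow> i \<le> d \<Longrightarrow> peval (M i) x * N i x = 1"
  by (auto simp: N_def peval_M torus_def)

lemma regular_N:
  assumes "i \<le> d"
  shows "regular d (N i)"
proof (cases "i = 0")
  case True
  then show ?thesis
    using regular_const[of d 1] by (simp add: N_def[abs_def] peval_M)
next
  case False
  then have i: "i \<in> {1..d}" using assms by auto
  show ?thesis
  proof (rule clears_intoI[where k = 1])
    show "(\<Prod>j\<in>{1..d} - {i}. Var j) \<in> polys {1..d}" by (rule polys_prod) auto
    fix x assume "x \<in> torus d"
    then show "peval (\<Prod>j\<in>{1..d} - {i}. Var j) x = (\<Prod>j=1..d. x j) ^ 1 * N i x"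
      using i by (auto simp: prod.remove[of "{1..d}" i] N_def peval_M torus_def)
  qed
qed

definition quadric :: "nat \<Rightarrow> nat \<Rightarrow> (nat \<Rightarrow> complex) \<Rightarrow> complex"
  where "quadric i j x =
      (of_nat j - of_nat i + 3) * N i x * N j x
    - 2 * (of_nat j - of_nat i + 2) * N (i - 1) x * N (j + 1) x
    + (of_nat j - of_nat i + 1) * N (i - 2) x * N (j + 2) x"

text \<open>Each of the three terms of the generator is the product of four of the six moments
  \<open>M\<^bsub>i-2\<^esub>, M\<^bsub>i-1\<^esub>, M\<^sub>i, M\<^sub>j, M\<^bsub>j+1\<^esub>, M\<^bsub>j+2\<^esub>\<close>; dividing by all six leaves the inverses of the other two.\<close>

lemma quadric_eq:
  assumes "x \<in> torus d" "2 \<le> i" "i \<le> j" "j \<le> d - 2"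
  shows "quadric i j x = peval (inv_generator i j) x *
    (N (i - 2) x * N (i - 1) x * N i x * N j x * N (j + 1) x * N (j + 2) x)"
proof -
  have one: "peval (M k) x * N k x = 1" if "k \<le> d" for k
    using peval_M_N[OF assms(1) that] .
  have identity: "(c1 * a * b * e * f - 2 * c2 * a * m * n * f + c3 * b * m * n * e)
      * (a' * b' * m' * n' * e' * f') =
      c1 * m' * n' * (a * a') * (b * b') * (e * e') * (f * f')
      - 2 * c2 * b' * e' * (a * a') * (m * m') * (n * n') * (f * f')
      + c3 * a' * f' * (b * b') * (m * m') * (n * n') * (e * e')"
    for c1 c2 c3 a b e f m n a' b' m' n' e' f' :: complex
    by (simp add: algebra_simps)
  have le: "i - 2 \<le> d" "i - 1 \<le> d" "i \<le> d" "j \<le> d" "j + 1 \<le> d" "j + 2 \<le> d"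
    using assms by auto
  have "peval (inv_generator i j) x =
      (of_nat j - of_nat i + 3) * peval (M (i - 2)) x * peval (M (i - 1)) x *
        peval (M (j + 1)) x * peval (M (j + 2)) x
      - 2 * (of_nat j - of_nat i + 2) * peval (M (i - 2)) x * peval (M i) x *
        peval (M j) x * peval (M (j + 2)) x
      + (of_nat j - of_nat i + 1) * peval (M (i - 1)) x * peval (M i) x *
        peval (M j) x * peval (M (j + 1)) x"
    by (simp add: inv_generator_def)
  then show ?thesis
    by (simp only: quadric_def identity one[OF le(1)] one[OF le(2)] one[OF le(3)]
        one[OF le(4)] one[OF le(5)] one[OF le(6)] mult_1_right)
qed

lemma inv_generator_in_polys:
  assumes "2 \<le> i" "i \<le> j" "j \<le> d - 2"
  shows "inv_generator i j \<in> polys {1..d}"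
  unfolding inv_generator_def using assms
  by (intro polys_add polys_diff polys_mult polys_of_nat polys_one polys_numeral M_in_polys) auto

lemma inv_generators_subset:
  "{inv_generator i j | i j. 2 \<le> i \<and> i \<le> j \<and> j \<le> d - 2} \<subseteq> polys {1..d}"
  using inv_generator_in_polys by blast

lemma inv_ideal_ideal: "ideal (inv_ideal d) (mpoly_ring {1..d})"
  unfolding inv_ideal_def
  by (rule ring.genideal_ideal[OF cring.axioms(1)[OF mpoly_ring_cring] inv_generators_subset])

lemma inv_generator_in_inv_ideal:
  assumes "2 \<le> i" "i \<le> j" "j \<le> d - 2"
  shows "inv_generator i j \<in> inv_ideal d"
  unfolding inv_ideal_def
  using ring.genideal_self[OF cring.axioms(1)[OF mpoly_ring_cring] inv_generators_subset, of d]
    assms by blast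

text \<open>Functions that are zero modulo the extended ideal.\<close>

abbreviation negligible :: "nat \<Rightarrow> ((nat \<Rightarrow> complex) \<Rightarrow> complex) \<Rightarrow> bool"
  where "negligible d \<equiv> clears_into d (inv_ideal d)"

lemmas negligible_add = clears_into_add[OF inv_ideal_ideal]
  and negligible_mult = clears_into_mult[OF inv_ideal_ideal]

lemma negligible_regular: "negligible d \<phi> \<Longrightarrow> regular d \<phi>"
  using clears_into_mono ideal_mpoly_ringD(1)[OF inv_ideal_ideal] by blast

lemma negligible_quadric:
  assumes "2 \<le> i" "i \<le> j" "j \<le> d - 2"
  shows "negligible d (quadric i j)"
proof (rule clears_into_cong[OF negligible_mult])
  show "negligible d (peval (inv_generator i j))"
    by (rule clears_into_peval[OF inv_generator_in_inv_ideal[OF assms]])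
  show "regular d (\<lambda>x. N (i - 2) x * N (i - 1) x * N i x * N j x * N (j + 1) x * N (j + 2) x)"
    using assms by (intro regular_mult regular_N) auto
qed (use quadric_eq assms in blast)

section \<open>The cuspidal normal form\<close>

text \<open>On the surface, with \<open>N\<^sub>i = (u - (i - 1) t) (u + t)\<^bsup>i-1\<^esup>\<close> for \<open>i \<ge> 1\<close>, this function takes the
  value \<open>t\<^sup>2\<close> and the next one the value \<open>t\<^sup>3\<close>.\<close>

definition t_squared :: "(nat \<Rightarrow> complex) \<Rightarrow> complex"
  where "t_squared x = N 1 x ^ 2 - N 2 x"

definition t_cubed :: "(nat \<Rightarrow> complex) \<Rightarrow> complex"
  where "t_cubed x = (N 1 x ^ 3 - 3 * N 1 x * t_squared x - N 3 x) / 2"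

definition plane_point :: "complex \<Rightarrow> complex \<Rightarrow> nat \<Rightarrow> complex"
  where "plane_point u v = (\<lambda>i. if i = 1 then u else if i = 2 then v else 0)"

lemma plane_point_simps [simp]: "plane_point u v 1 = u" "plane_point u v 2 = v"
  by (simp_all add: plane_point_def)

abbreviation plane_eval :: "cmpoly \<Rightarrow> (nat \<Rightarrow> complex) \<Rightarrow> complex"
  where "plane_eval p x \<equiv> peval p (plane_point (N 1 x) (t_squared x))"

text \<open>Solving the quadrics for \<open>(2, 2)\<close> and \<open>(2, 3)\<close> for \<open>N\<^sub>4\<close> and \<open>N\<^sub>5\<close> and inserting the result into the
  quadric for \<open>(3, 3)\<close> gives 12 times the cuspidal relation; the cofactors below record this
  elimination.\<close>

lemma negligible_cusp:
  assumes "d \<ge> 5"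
  shows "negligible d (\<lambda>x. t_cubed x ^ 2 - t_squared x ^ 3)"
proof (rule clears_into_cong)
  have q: "negligible d (quadric 2 2)" "negligible d (quadric 2 3)" "negligible d (quadric 3 3)"
    using assms by (intro negligible_quadric; simp)+
  have r: "regular d (N 1)" "regular d (N 2)"
    using assms by (intro regular_N; simp)+
  show "negligible d (\<lambda>x. quadric 3 3 x * (1 / 12)
      + (quadric 2 2 x * (1 / 12 * (4 * N 2 x - 3 * N 1 x ^ 2))
      + quadric 2 3 x * (- 1 / 24 * N 1 x)))"
    by (intro negligible_add negligible_mult q regular_const regular_mult regular_diff
        regular_power r)
  fix x
  show "t_cubed x ^ 2 - t_squared x ^ 3 = quadric 3 3 x * (1 / 12)
      + (quadric 2 2 x * (1 / 12 * (4 * N 2 x - 3 * N 1 x ^ 2))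
      + quadric 2 3 x * (- 1 / 24 * N 1 x))"
  proof -
    have q: "quadric 2 2 x = 3 * N 2 x ^ 2 - 4 * (N 1 x * N 3 x) + N 4 x"
      "quadric 2 3 x = 4 * (N 2 x * N 3 x) - 6 * (N 1 x * N 4 x) + 2 * N 5 x"
      "quadric 3 3 x = 3 * N 3 x ^ 2 - 4 * (N 2 x * N 4 x) + N 1 x * N 5 x"
      by (simp_all add: quadric_def power2_eq_square flip: One_nat_def)
    have identity: "((n1 ^ 3 - 3 * n1 * (n1 ^ 2 - n2) - n3) / 2) ^ 2 - (n1 ^ 2 - n2) ^ 3 =
        (3 * n3 ^ 2 - 4 * (n2 * n4) + n1 * n5) * (1 / 12)
        + ((3 * n2 ^ 2 - 4 * (n1 * n3) + n4) * (1 / 12 * (4 * n2 - 3 * n1 ^ 2))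
        + (4 * (n2 * n3) - 6 * (n1 * n4) + 2 * n5) * (- 1 / 24 * n1))"
      for n1 n2 n3 n4 n5 :: complex
      by (simp add: power2_eq_square power3_eq_cube field_simps)
    show ?thesis unfolding q t_cubed_def t_squared_def by (rule identity)
  qed
qed

text \<open>Congruence to an element \<open>a(u, t_squared) + b(u, t_squared) t_cubed\<close> of the coordinate ring of
  the cuspidal surface, written in its basis \<open>1, t_cubed\<close> over polynomials in \<open>u\<close> and \<open>t_squared\<close>.\<close>

definition has_normal_form :: "nat \<Rightarrow> ((nat \<Rightarrow> complex) \<Rightarrow> complex) \<Rightarrow> bool"
  where "has_normal_form d \<phi> \<longleftrightarrow> (\<exists>a b.
    negligible d (\<lambda>x. \<phi> x -
      (plane_eval a x + plane_eval b x * t_cubed x)))"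

lemma has_normal_formI:
  assumes "\<And>x. \<phi> x = plane_eval a x + plane_eval b x * t_cubed x"
  shows "has_normal_form d \<phi>"
  unfolding has_normal_form_def
  by (intro exI[of _ a] exI[of _ b] clears_into_cong[OF clears_into_zero[OF inv_ideal_ideal]])
    (simp add: assms)

lemma has_normal_form_modulo:
  assumes "has_normal_form d \<psi>" "negligible d \<chi>" "\<And>x. \<phi> x = \<psi> x + \<chi> x"
  shows "has_normal_form d \<phi>"
proof -
  from assms(1) obtain a b where "negligible d (\<lambda>x. \<psi> x -
      (plane_eval a x + plane_eval b x * t_cubed x))"
    by (auto simp: has_normal_form_def)
  from negligible_add[OF this assms(2)] show ?thesis
    unfolding has_normal_form_def
    by (intro exI[of _ a] exI[of _ b]) (simp add: assms(3) algebra_simps)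
qed

lemma has_normal_form_add:
  assumes "has_normal_form d \<phi>" "has_normal_form d \<psi>"
  shows "has_normal_form d (\<lambda>x. \<phi> x + \<psi> x)"
proof -
  from assms obtain a b a' b' where "negligible d (\<lambda>x. \<phi> x -
      (plane_eval a x + plane_eval b x * t_cubed x))"
    "negligible d (\<lambda>x. \<psi> x -
      (plane_eval a' x + plane_eval b' x * t_cubed x))"
    by (auto simp: has_normal_form_def)
  from negligible_add[OF this] show ?thesis
    unfolding has_normal_form_def
    by (intro exI[of _ "a + a'"] exI[of _ "b + b'"]) (simp add: algebra_simps)
qed

context
  fixes d :: nat
  assumes d: "d \<ge> 5"
begin

lemma regular_t_squared: "regular d t_squared"
  unfolding t_squared_def using d by (intro regular_diff regular_power regular_N) auto

lemma regular_t_cubed: "regular d t_cubed"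
proof -
  have "regular d (\<lambda>x. (N 1 x ^ 3 - 3 * N 1 x * t_squared x - N 3 x) * (1 / 2))"
    using d by (intro regular_diff regular_mult regular_power regular_N regular_t_squared regular_const) auto
  then show ?thesis by (simp add: t_cubed_def[abs_def])
qed

lemma regular_plane_point: "regular d (\<lambda>x. plane_eval p x)"
proof (rule regular_peval_comp)
  fix i show "regular d (\<lambda>x. plane_point (N 1 x) (t_squared x) i)"
    using regular_N[of 1 d] regular_t_squared regular_const[of d 0] d
    by (cases "i = 1"; cases "i = 2") (simp_all add: plane_point_def)
qed

text \<open>The only product outside the normal form is that of the two \<open>t_cubed\<close> parts, and there the
  cuspidal relation replaces \<open>t_cubed\<^sup>2\<close> by \<open>t_squared\<^sup>3\<close>.\<close>

lemma has_normal_form_mult: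
  assumes "has_normal_form d \<phi>" "has_normal_form d \<psi>"
  shows "has_normal_form d (\<lambda>x. \<phi> x * \<psi> x)"
proof -
  from assms obtain a b a' b' where
    1: "negligible d (\<lambda>x. \<phi> x - (plane_eval a x + plane_eval b x * t_cubed x))" and
    2: "negligible d (\<lambda>x. \<psi> x - (plane_eval a' x + plane_eval b' x * t_cubed x))"
    by (auto simp: has_normal_form_def)
  have reg: "regular d (\<lambda>x. plane_eval p x + plane_eval q x * t_cubed x)" for p q
    by (intro regular_add regular_mult regular_plane_point regular_t_cubed)
  have "regular d (\<lambda>x. (\<psi> x - (plane_eval a' x + plane_eval b' x * t_cubed x))
      + (plane_eval a' x + plane_eval b' x * t_cubed x))"
    by (intro regular_add negligible_regular[OF 2] reg)
  then have reg\<psi>: "regular d \<psi>" by simp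
  have "negligible d (\<lambda>x. (\<phi> x - (plane_eval a x + plane_eval b x * t_cubed x)) * \<psi> x
      + ((\<psi> x - (plane_eval a' x + plane_eval b' x * t_cubed x)) * (plane_eval a x + plane_eval b x * t_cubed x)
      + (t_cubed x ^ 2 - t_squared x ^ 3) * (plane_eval b x * plane_eval b' x)))"
    by (intro negligible_add negligible_mult 1 2 negligible_cusp d reg reg\<psi> regular_mult
        regular_plane_point)
  then have "negligible d (\<lambda>x. \<phi> x * \<psi> x -
      (plane_eval (a * a' + b * b' * Var 2 ^ 3) x + plane_eval (a * b' + a' * b) x * t_cubed x))"
    by (rule clears_into_cong) (simp add: algebra_simps power2_eq_square)
  then show ?thesis unfolding has_normal_form_def by blast
qed

lemma has_normal_form_const: "has_normal_form d (\<lambda>_. c)"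
  by (rule has_normal_formI[of _ "Const c" 0]) simp

lemma has_normal_form_N: "i \<le> d \<Longrightarrow> has_normal_form d (N i)"
proof (induction i rule: less_induct)
  case (less i)
  consider "i = 0" | "i = 1" | "i = 2" | "i = 3" | "i \<ge> 4" by linarith
  then show ?case
  proof cases
    case 1
    then show ?thesis by (intro has_normal_formI[of _ 1 0]) simp
  next
    case 2
    then show ?thesis by (intro has_normal_formI[of _ "Var 1" 0]) simp
  next
    case 3
    then show ?thesis
      by (intro has_normal_formI[of _ "Var 1 ^ 2 - Var 2" 0]) (simp add: t_squared_def)
  next
    case 4
    then show ?thesis
      by (intro has_normal_formI[of _ "Var 1 ^ 3 - 3 * Var 1 * Var 2" "- 2"])
        (simp add: t_cubed_def field_simps)
  next
    case 5
    \<comment> \<open>The quadric for \<open>(2, j)\<close> contains \<open>N (j + 2)\<close> with the nonzero coefficient \<open>j - 1\<close>.\<close>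
    define j where "j = i - 2"
    have j: "j \<ge> 2" "i = j + 2" "j \<le> d - 2" using 5 less.prems by (auto simp: j_def)
    define c where "c = (of_nat j - 1 :: complex)"
    have c: "c \<noteq> 0"
      using j(1) by (simp add: c_def)
    let ?\<psi> = "\<lambda>x. (2 * of_nat j / c) * (N 1 x * N (j + 1) x)
      + (- (of_nat j + 1) / c) * (N 2 x * N j x)"
    show ?thesis
    proof (rule has_normal_form_modulo)
      show "has_normal_form d ?\<psi>"
        using j less.prems
        by (intro has_normal_form_add has_normal_form_mult has_normal_form_const less.IH) auto
      show "negligible d (\<lambda>x. quadric 2 j x * (1 / c))"
        by (intro negligible_mult negligible_quadric regular_const) (use j in auto)
      fix x
      have two: "(2::nat) - 1 = 1" by simp
      have "quadric 2 j x =
          (of_nat j + 1) * (N 2 x * N j x) - 2 * of_nat j * (N 1 x * N (j + 1) x) + c * N i x"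
        unfolding quadric_def two c_def j(2) by (simp add: algebra_simps)
      then have "c * N i x = quadric 2 j x + 2 * of_nat j * (N 1 x * N (j + 1) x)
          - (of_nat j + 1) * (N 2 x * N j x)"
        by simp
      then have "N i x = (quadric 2 j x + 2 * of_nat j * (N 1 x * N (j + 1) x)
          - (of_nat j + 1) * (N 2 x * N j x)) / c"
        using c by (metis nonzero_mult_div_cancel_left)
      also have "\<dots> = ?\<psi> x + quadric 2 j x * (1 / c)"
        using c by (simp add: field_simps)
      finally show "N i x = ?\<psi> x + quadric 2 j x * (1 / c)" .
    qed
  qed
qed

lemma has_normal_form_peval_N:
  assumes "G \<in> polys {1..d}"
  shows "has_normal_form d (\<lambda>x. peval G (\<lambda>i. N i x))"
  using assms
proof (induction rule: cmpoly_induct)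
  case (Const c)
  show ?case by (simp add: has_normal_form_const)
next
  case (Var i)
  then show ?case using has_normal_form_N[of i] by simp
next
  case (add p q)
  then show ?case using has_normal_form_add by simp
next
  case (mult p q)
  then show ?case using has_normal_form_mult by simp
qed

end

text \<open>The map \<open>(u, t) \<mapsto> (u, t\<^sup>2, t\<^sup>3)\<close> has the cuspidal relation as its only relation. The hypothesis
  concerns an open set of real parameters, so the identity theorem first extends it to all complex \<open>(u, t)\<close>;
  comparing \<open>t\<close> with \<open>- t\<close> then separates \<open>a\<close> from \<open>b\<close>.\<close>

lemma cuspidal_parametrization_injective:
  assumes van: "\<And>u t. u > c \<Longrightarrow> 0 < t \<Longrightarrow> t < 1 \<Longrightarrow>
    peval a (plane_point (of_real u) (of_real t ^ 2)) +
    peval b (plane_point (of_real u) (of_real t ^ 2)) * of_real t ^ 3 = 0"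
  shows "peval a (plane_point u v) = 0" "peval b (plane_point u v) = 0"
proof -
  define y where "y = (\<lambda>i::nat. if i = 1 then Var 1 else if i = 2 then Var 2 ^ 2 else 0)"
  define H where "H = subst_eval Const y a + subst_eval Const y b * Var 2 ^ 3"
  have y: "subst_eval Const y p \<in> polys {1, 2}" for p
    by (rule subst_in_polys[OF cmpoly_UNIV]) (simp add: y_def)
  have ev: "peval (subst_eval Const y p) x = peval p (plane_point (x 1) (x 2 ^ 2))" for p x
  proof -
    have "(\<lambda>i. peval (y i) x) = plane_point (x 1) (x 2 ^ 2)"
      by (auto simp: y_def plane_point_def)
    then show ?thesis by (simp add: peval_subst)
  qed
  have inf: "infinite {c<..}" "infinite {0<..<1::real}"
    by (simp_all add: infinite_Ioi infinite_Ioo)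
  have "H = 0"
  proof (rule identity_theorem[of "{1, 2}" H
        "\<lambda>i. complex_of_real ` (if i = 1 then {c<..} else {0<..<1})"])
    show "H \<in> polys {1, 2}" unfolding H_def using y by simp
    fix x :: "nat \<Rightarrow> complex"
    assume x: "\<And>i. i \<in> {1, 2} \<Longrightarrow>
      x i \<in> complex_of_real ` (if i = 1 then {c<..} else {0<..<1})"
    from x[of 1] x[of 2] obtain u t where "x 1 = of_real u" "u > c" "x 2 = of_real t"
      "0 < t" "t < 1" by auto
    then show "peval H x = 0" using van[of u t] by (simp add: H_def ev)
  qed (use inf in \<open>auto simp: finite_image_iff inj_on_def\<close>)
  then have H: "peval a (plane_point u (t ^ 2)) + peval b (plane_point u (t ^ 2)) * t ^ 3 = 0"
    for u t
  proof -
    have "peval H (plane_point u t) = 0" using \<open>H = 0\<close> by simp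
    then show ?thesis by (simp add: H_def ev)
  qed
  have split: "peval a (plane_point u (t ^ 2)) = 0 \<and>
      peval b (plane_point u (t ^ 2)) * t ^ 3 = 0" for u t
    using H[of u t] H[of u "- t"] by (simp add: add_eq_0_iff)
  have root: "\<exists>t. v = t ^ 2" for v :: complex
    by (metis power2_csqrt)
  show "peval a (plane_point u v) = 0"
    using split root by metis
  \<comment> \<open>The factor \<open>t ^ 3\<close> can be cancelled only for \<open>t \<noteq> 0\<close>; the value at \<open>v = 0\<close> comes from
      the identity theorem.\<close>
  have "subst_eval Const y b = 0"
  proof (rule identity_theorem[OF _ y, where A = "\<lambda>_. - {0}"])
    fix x :: "nat \<Rightarrow> complex"
    assume "\<And>i. i \<in> {1, 2} \<Longrightarrow> x i \<in> - {0}"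
    then have "x 2 \<noteq> 0" by auto
    with split[of "x 1" "x 2"] show "peval (subst_eval Const y b) x = 0"
      by (simp add: ev)
  qed (auto simp: infinite_UNIV_char_0 Compl_eq_Diff_UNIV)
  moreover obtain t where "v = t ^ 2" using root by blast
  ultimately show "peval b (plane_point u v) = 0"
    using ev[where p = b and x = "plane_point u t"] by simp
qed

section \<open>Comparison of the two ideals\<close>

lemma N_pareto_point:
  assumes "\<alpha> > real d" "\<xi> > 0" "k \<le> d"
  shows "N k (pareto_point d \<alpha> \<xi>) = of_real ((1 - real k / \<alpha>) * inverse \<xi> ^ k)"
proof -
  have "\<alpha> > 0" "\<alpha> - real k > 0" using assms by auto
  have "N k (pareto_point d \<alpha> \<xi>) = inverse (of_real (pareto_moment \<alpha> \<xi> k))"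
    using assms(3) \<open>\<alpha> > 0\<close> by (simp add: N_def peval_M pareto_point_def pareto_moment_def)
  also have "\<dots> = of_real (inverse (pareto_moment \<alpha> \<xi> k))" by simp
  also have "inverse (pareto_moment \<alpha> \<xi> k) = (1 - real k / \<alpha>) * inverse \<xi> ^ k"
    using \<open>\<alpha> > 0\<close> \<open>\<alpha> - real k > 0\<close> \<open>\<xi> > 0\<close>
    by (simp add: pareto_moment_def field_simps)
  finally show ?thesis .
qed

lemma pareto_points_torus: "x \<in> pareto_points d \<Longrightarrow> x \<in> torus d"
  using pareto_points_nonzero by (auto simp: torus_def)

lemma quadric_pareto_points:
  assumes "x \<in> pareto_points d" "2 \<le> i" "i \<le> j" "j \<le> d - 2"
  shows "quadric i j x = 0"
proof -
  obtain \<alpha> \<xi> where x: "x = pareto_point d \<alpha> \<xi>" "\<alpha> > real d" "\<xi> > 0"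
    using assms(1) by (auto simp: pareto_points_def)
  define b z where "b = complex_of_real (1 / \<alpha>)" and "z = complex_of_real (inverse \<xi>)"
  define p q where "p = z ^ (i - 2)" and "q = z ^ j"
  have N_eq: "N k x = (1 - of_nat k * b) * z ^ k" if "k \<le> d" for k
    using N_pareto_point[OF x(2,3) that] by (simp add: x(1) b_def z_def)
  obtain i' where i: "i = i' + 2" using assms(2) le_Suc_ex by (metis add.commute)
  have N_values: "N i x = (1 - of_nat i * b) * (p * z ^ 2)"
    "N (i - 1) x = (1 - (of_nat i - 1) * b) * (p * z)"
    "N (i - 2) x = (1 - (of_nat i - 2) * b) * p"
    "N j x = (1 - of_nat j * b) * q"
    "N (j + 1) x = (1 - (of_nat j + 1) * b) * (q * z)"
    "N (j + 2) x = (1 - (of_nat j + 2) * b) * (q * z ^ 2)"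
    using assms by (simp_all add: N_eq p_def q_def i power_add algebra_simps power2_eq_square)
  have identity: "(J - I + 3) * ((1 - I * b) * (p * z ^ 2)) * ((1 - J * b) * q)
      - 2 * (J - I + 2) * ((1 - (I - 1) * b) * (p * z)) * ((1 - (J + 1) * b) * (q * z))
      + (J - I + 1) * ((1 - (I - 2) * b) * p) * ((1 - (J + 2) * b) * (q * z ^ 2)) = 0"
    for I J :: complex
    by (simp add: algebra_simps power2_eq_square)
  show ?thesis unfolding quadric_def N_values by (rule identity)
qed

lemma inv_ideal_vanishes:
  assumes "r \<in> inv_ideal d" "x \<in> pareto_points d"
  shows "peval r x = 0"
proof (rule genideal_vanishing(2)[OF inv_generators_subset _ assms(1)[unfolded inv_ideal_def] assms(2)])
  fix f y
  assume "f \<in> {inv_generator i j | i j. 2 \<le> i \<and> i \<le> j \<and> j \<le> d - 2}" and y: "y \<in> pareto_points d"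
  then obtain i j where ij: "f = inv_generator i j" "2 \<le> i" "i \<le> j" "j \<le> d - 2" by blast
  have nz: "N k y \<noteq> 0" if "k \<le> d" for k
    using peval_M_N[OF pareto_points_torus[OF y] that] by auto
  show "peval f y = 0"
    using quadric_eq[OF pareto_points_torus[OF y] ij(2-4)]
      quadric_pareto_points[OF y ij(2-4)] ij nz by auto
qed

lemma negligible_vanishes:
  assumes "negligible d \<phi>" "x \<in> pareto_points d"
  shows "\<phi> x = 0"
proof -
  from assms(1) obtain r k where "r \<in> inv_ideal d"
    "\<And>x. x \<in> torus d \<Longrightarrow> peval r x = (\<Prod>i=1..d. x i) ^ k * \<phi> x"
    unfolding clears_into_def by blast
  then have "(\<Prod>i=1..d. x i) ^ k * \<phi> x = 0"
    using inv_ideal_vanishes assms(2) pareto_points_torus by metis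
  then show ?thesis
    using pareto_points_nonzero[OF assms(2)] by auto
qed

text \<open>Since \<open>M\<^sub>i\<close> is the product of all coordinates times the \<open>N\<^sub>j\<close> with \<open>j \<noteq> i\<close>, every polynomial in the
  moments is a polynomial in the inverse moments up to a power of that product.\<close>

lemma exists_inverse_form:
  assumes "f \<in> polys {1..d}"
  shows "\<exists>n. \<exists>G\<in>polys {1..d}. \<forall>x\<in>torus d.
    peval f x = (\<Prod>i=1..d. x i) ^ n * peval G (\<lambda>i. N i x)"
  using assms
proof (induction rule: cmpoly_induct)
  case (Const c)
  show ?case by (intro exI[of _ 0] bexI[of _ "Const c"]) auto
next
  case (Var i)
  show ?case
  proof (intro exI[of _ 1] bexI ballI)
    show "(\<Prod>j\<in>{1..d} - {i}. Var j) \<in> polys {1..d}" by (rule polys_prod) auto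
    fix x assume x: "x \<in> torus d"
    have "(\<Prod>j\<in>{1..d} - {i}. x j) * (\<Prod>j\<in>{1..d} - {i}. N j x) = 1"
      unfolding prod.distrib[symmetric]
    proof (rule prod.neutral, rule ballI)
      fix j assume "j \<in> {1..d} - {i}"
      then show "x j * N j x = 1" using peval_M_N[OF x, of j] by (auto simp: peval_M)
    qed
    then show "peval (Var i) x =
        (\<Prod>i=1..d. x i) ^ 1 * peval (\<Prod>j\<in>{1..d} - {i}. Var j) (\<lambda>i. N i x)"
      using Var by (simp add: prod.remove[of "{1..d}" i] mult.assoc)
  qed
next
  case (add p q)
  then obtain m n G H where G: "G \<in> polys {1..d}"
      "\<forall>x\<in>torus d. peval p x = (\<Prod>i=1..d. x i) ^ m * peval G (\<lambda>i. N i x)"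
    and H: "H \<in> polys {1..d}"
      "\<forall>x\<in>torus d. peval q x = (\<Prod>i=1..d. x i) ^ n * peval H (\<lambda>i. N i x)" by blast
  let ?g = "\<Prod>i=1..d. Var i"
  show ?case
  proof (intro exI[of _ "m + n"] bexI ballI)
    \<comment> \<open>Evaluated at the inverse moments, \<open>?g\<close> is the inverse of the product of the coordinates, so its
      powers adjust the two summands to the common exponent \<open>m + n\<close>.\<close>
    show "G * ?g ^ n + H * ?g ^ m \<in> polys {1..d}"
      by (intro polys_add polys_mult polys_power prod_Var_in_polys G(1) H(1))
    fix x assume x: "x \<in> torus d"
    have inv: "(\<Prod>i=1..d. x i) * (\<Prod>i=1..d. N i x) = 1"
      unfolding prod.distrib[symmetric]
    proof (rule prod.neutral, rule ballI)
      fix j assume "j \<in> {1..d}"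
      then show "x j * N j x = 1" using peval_M_N[OF x, of j] by (auto simp: peval_M)
    qed
    have inv_power: "(\<Prod>i=1..d. x i) ^ k * (\<Prod>i=1..d. N i x) ^ k = 1" for k
      unfolding power_mult_distrib[symmetric] inv by simp
    have "(\<Prod>i=1..d. x i) ^ (m + n) * peval (G * ?g ^ n + H * ?g ^ m) (\<lambda>i. N i x) =
        (\<Prod>i=1..d. x i) ^ m * peval G (\<lambda>i. N i x) *
          ((\<Prod>i=1..d. x i) ^ n * (\<Prod>i=1..d. N i x) ^ n) +
        (\<Prod>i=1..d. x i) ^ n * peval H (\<lambda>i. N i x) *
          ((\<Prod>i=1..d. x i) ^ m * (\<Prod>i=1..d. N i x) ^ m)"
      by (simp add: power_add algebra_simps)
    then show "peval (p + q) x =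
        (\<Prod>i=1..d. x i) ^ (m + n) * peval (G * ?g ^ n + H * ?g ^ m) (\<lambda>i. N i x)"
      using x G(2) H(2) by (simp only: inv_power) simp
  qed
next
  case (mult p q)
  then obtain m n G H where "G \<in> polys {1..d}"
      "\<forall>x\<in>torus d. peval p x = (\<Prod>i=1..d. x i) ^ m * peval G (\<lambda>i. N i x)"
      "H \<in> polys {1..d}"
      "\<forall>x\<in>torus d. peval q x = (\<Prod>i=1..d. x i) ^ n * peval H (\<lambda>i. N i x)" by blast
  then show ?case
    by (intro exI[of _ "m + n"] bexI[of _ "G * H"]) (auto simp: power_add mult_ac)
qed

text \<open>The normal form of such a polynomial vanishes at the Pareto points, and these cover an open set of real
  parameters \<open>u\<close> and \<open>t\<close>, so the normal form is zero.\<close>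

lemma negligible_of_vanishes:
  assumes d: "d \<ge> 5" and f: "f \<in> polys {1..d}" "\<And>x. x \<in> pareto_points d \<Longrightarrow> peval f x = 0"
  shows "negligible d (peval f)"
proof -
  obtain n G where G: "G \<in> polys {1..d}"
    "\<And>x. x \<in> torus d \<Longrightarrow> peval f x = (\<Prod>i=1..d. x i) ^ n * peval G (\<lambda>i. N i x)"
    using exists_inverse_form[OF f(1)] by blast
  obtain a b where ab: "negligible d (\<lambda>x. peval G (\<lambda>i. N i x) -
      (plane_eval a x + plane_eval b x * t_cubed x))"
    using has_normal_form_peval_N[OF d G(1)] unfolding has_normal_form_def by blast
  have zero: "peval a (plane_point (of_real u) (of_real t ^ 2)) +
      peval b (plane_point (of_real u) (of_real t ^ 2)) * of_real t ^ 3 = 0"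
    if ut: "u > real d" "0 < t" "t < 1" for u t
  proof -
    \<comment> \<open>Here \<open>1 / \<xi> = \<zeta> = u + t\<close> and \<open>1 / \<alpha> = \<beta> = t / \<zeta>\<close>; the bounds on \<open>u\<close> and \<open>t\<close> ensure \<open>\<alpha> > d\<close>.\<close>
    define \<alpha> \<xi> where "\<alpha> = (u + t) / t" and "\<xi> = inverse (u + t)"
    define x where "x = pareto_point d \<alpha> \<xi>"
    have pos: "u + t > 0" using ut by auto
    have "real d * t \<le> real d * 1" using ut by (intro mult_left_mono) auto
    then have \<alpha>: "\<alpha> > real d" using ut by (simp add: \<alpha>_def field_simps)
    have \<xi>: "\<xi> > 0" using pos by (simp add: \<xi>_def)
    have x: "x \<in> pareto_points d" using \<alpha> \<xi> by (auto simp: x_def pareto_points_def)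
    have Nx: "N (Suc k) x = of_real ((u - real k * t) * (u + t) ^ k)" if "Suc k \<le> d" for k
    proof -
      have "1 - real (Suc k) / \<alpha> = (u - real k * t) / (u + t)"
        using ut pos by (simp add: \<alpha>_def field_simps)
      then show ?thesis
        using N_pareto_point[OF \<alpha> \<xi> that] pos by (simp add: x_def \<xi>_def)
    qed
    have N1: "N 1 x = of_real u" using Nx[of 0, folded One_nat_def] d by simp
    have N2: "N 2 x = (of_real u - of_real t) * (of_real u + of_real t)"
      using Nx[of 1] d by simp
    have N3: "N 3 x = (of_real u - 2 * of_real t) * (of_real u + of_real t) ^ 2"
      using Nx[of 2] d by simp
    have Tx: "t_squared x = of_real t ^ 2"
      by (simp add: t_squared_def N1 N2 algebra_simps power2_eq_square)
    have Sx: "t_cubed x = of_real t ^ 3"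
      by (simp add: t_cubed_def Tx N1 N3 algebra_simps power2_eq_square power3_eq_cube)
    have "(\<Prod>i=1..d. x i) \<noteq> 0" using pareto_points_nonzero[OF x] by simp
    then have "peval G (\<lambda>i. N i x) = 0"
      using f(2)[OF x] G(2)[OF pareto_points_torus[OF x]] by simp
    then have "plane_eval a x + plane_eval b x * t_cubed x = 0"
      using negligible_vanishes[OF ab x] by (simp only: diff_0 neg_equal_0_iff_equal)
    then show ?thesis by (simp only: N1 Tx Sx)
  qed
  have "plane_eval a x = 0" "plane_eval b x = 0" for x
    using cuspidal_parametrization_injective[OF zero] by blast+
  with ab have "negligible d (\<lambda>x. peval G (\<lambda>i. N i x))" by simp
  moreover have "regular d (\<lambda>x. (\<Prod>i=1..d. x i) ^ n)"
    using clears_into_peval[OF polys_power[OF prod_Var_in_polys, of d n], of d] by simp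
  ultimately have "negligible d (\<lambda>x. peval G (\<lambda>i. N i x) * (\<Prod>i=1..d. x i) ^ n)"
    by (rule negligible_mult)
  then show ?thesis
    by (rule clears_into_cong) (simp add: G(2) mult.commute)
qed

lemma peval_eq_on_torus_imp_eq:
  assumes "p \<in> polys {1..d}" "q \<in> polys {1..d}" "\<And>x. x \<in> torus d \<Longrightarrow> peval p x = peval q x"
  shows "p = q"
proof -
  have "p - q = 0"
  proof (rule identity_theorem[of "{1..d}" _ "\<lambda>_. - {0}"])
    show "infinite (- {0::complex})"
      by (simp add: infinite_UNIV_char_0 Compl_eq_Diff_UNIV)
    fix x :: "nat \<Rightarrow> complex" assume "\<And>i. i \<in> {1..d} \<Longrightarrow> x i \<in> - {0}"
    then have "x \<in> torus d" by (auto simp: torus_def)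
    then show "peval (p - q) x = 0" using assms(3) by simp
  qed (use assms in auto)
  then show ?thesis by simp
qed

lemma prod_M: "(\<Prod>i=1..d. M i) = (\<Prod>i=1..d. Var i)"
  by (rule prod.cong) (auto simp: M_def)

theorem theorem4p2:
  fixes d :: nat
  assumes "d \<ge> 6"
  shows "affine_pareto_moment_ideal d =
    saturation (mpoly_ring {1..d}) (inv_ideal d) (\<Prod>i = 1..d. M i)"
proof (intro equalityI subsetI)
  fix f assume "f \<in> affine_pareto_moment_ideal d"
  then have f: "f \<in> polys {1..d}" "\<And>x. x \<in> pareto_points d \<Longrightarrow> peval f x = 0"
    by (auto simp: affine_pareto_moment_ideal_eq)
  have "negligible d (peval f)" using negligible_of_vanishes f assms by simp
  then obtain r k where r: "r \<in> inv_ideal d"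
    "\<And>x. x \<in> torus d \<Longrightarrow> peval r x = (\<Prod>i=1..d. x i) ^ k * peval f x"
    unfolding clears_into_def by blast
  have "r = (\<Prod>i=1..d. Var i) ^ k * f"
  proof (rule peval_eq_on_torus_imp_eq)
    show "r \<in> polys {1..d}" using r(1) ideal_mpoly_ringD(1)[OF inv_ideal_ideal] by blast
    show "(\<Prod>i=1..d. Var i) ^ k * f \<in> polys {1..d}"
      by (intro polys_mult polys_power prod_Var_in_polys f(1))
  qed (simp add: r(2))
  with r(1) f(1) show "f \<in> saturation (mpoly_ring {1..d}) (inv_ideal d) (\<Prod>i=1..d. M i)"
    by (auto simp: saturation_def prod_M)
next
  fix f assume "f \<in> saturation (mpoly_ring {1..d}) (inv_ideal d) (\<Prod>i=1..d. M i)"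
  then obtain k where f: "f \<in> polys {1..d}" "(\<Prod>i=1..d. Var i) ^ k * f \<in> inv_ideal d"
    by (auto simp: saturation_def prod_M)
  have "peval f x = 0" if x: "x \<in> pareto_points d" for x
    using inv_ideal_vanishes[OF f(2) x] pareto_points_nonzero[OF x] by simp
  with f(1) show "f \<in> affine_pareto_moment_ideal d"
    by (simp add: affine_pareto_moment_ideal_eq)
qed

end
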